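(* For any graphs $G$ and $H$, of orders $n_G$ and $n_H$ respectively, \[ A(G+H,x)=A(G,x)+A(H,x)+n_G\,x\,I(H,x)+n_H\,x\,I(G,x)+\left(\binom{n}{2}-2n_Gn_H-\binom{n_G}{2}-\binom{n_H}{2}\right)x^2-nx-1, \] where $n=n_G+n_H$.
   Context: Graphs are finite, undirected and simple. The acyclic polynomial of a graph $G$ is $A(G,x)=\sum_{i\ge 0} a_i x^i$, where $a_i=|\{S\subseteq V(G): |S|=i \text{ and } G[S] \text{ is acyclic}\}|$ and $G[S]$ is the subgraph of $G$ induced by $S$ (acyclic means containing no cycle; the empty set is acyclic). The independence polynomial is $I(G,x)=\sum_{k\ge 0} i_k x^k$, where $i_k$ is the number of independent sets of $G$ of cardinality $k$ (including the empty set). The join $G+H$ is formed from the disjoint union of $G$ and $H$ by adding all edges between a vertex of $G$ and a vertex of $H$. *)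

theory Defs
  imports "HOL-Computational_Algebra.Polynomial"
begin

record 'a graph =
  verts :: "'a set"
  edges :: "'a set set"

definition simple_graph :: "'a graph \<Rightarrow> bool" where
  "simple_graph G \<longleftrightarrow> finite (verts G) \<and> (\<forall>e\<in>edges G. e \<subseteq> verts G \<and> card e = 2)"

definition induced :: "'a graph \<Rightarrow> 'a set \<Rightarrow> 'a graph" where
  "induced G S = \<lparr>verts = S, edges = {e \<in> edges G. e \<subseteq> S}\<rparr>"

text \<open>A cycle is given by the list of its pairwise distinct vertices; the first vertex is
  not repeated at the end.\<close>

definition is_cycle :: "'a graph \<Rightarrow> 'a list \<Rightarrow> bool" where
  "is_cycle G p \<longleftrightarrow> 3 \<le> length p \<and> distinct p \<and> set p \<subseteq> verts G \<and>
     (\<forall>i<length p. {p ! i, p ! (Suc i mod length p)} \<in> edges G)"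

definition acyclic_graph :: "'a graph \<Rightarrow> bool" where
  "acyclic_graph G \<longleftrightarrow> (\<nexists>p. is_cycle G p)"

definition independent_set :: "'a graph \<Rightarrow> 'a set \<Rightarrow> bool" where
  "independent_set G S \<longleftrightarrow> S \<subseteq> verts G \<and> (\<forall>u\<in>S. \<forall>v\<in>S. {u, v} \<notin> edges G)"

text \<open>In both polynomials the coefficients of degree exceeding the order of the graph vanish,
  so the sums stop there. The coefficients are taken in the integers because the join formula
  involves subtraction.\<close>

definition acyclic_poly :: "'a graph \<Rightarrow> int poly" where
  "acyclic_poly G = (\<Sum>i\<le>card (verts G).
     monom (int (card {S. S \<subseteq> verts G \<and> card S = i \<and> acyclic_graph (induced G S)})) i)"

definition independence_poly :: "'a graph \<Rightarrow> int poly" where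
  "independence_poly G = (\<Sum>k\<le>card (verts G).
     monom (int (card {S. independent_set G S \<and> card S = k})) k)"

definition graph_join :: "'a graph \<Rightarrow> 'b graph \<Rightarrow> ('a + 'b) graph" where
  "graph_join G H =
     \<lparr>verts = verts G <+> verts H,
      edges = (\<lambda>e. Inl ` e) ` edges G \<union> (\<lambda>e. Inr ` e) ` edges H \<union>
              {{Inl u, Inr v} | u v. u \<in> verts G \<and> v \<in> verts H}\<rparr>"

abbreviation X :: "int poly" where
  "X \<equiv> [:0, 1:]"

end

theory Submission
  imports Defs
begin

text \<open>
  A vertex set of the join is a disjoint sum \<open>A <+> B\<close> of a vertex set \<open>A\<close> of \<open>G\<close> and a vertex
  set \<open>B\<close> of \<open>H\<close>.  If one part is empty, the induced subgraph is a copy of the subgraph induced in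
  \<open>G\<close> or in \<open>H\<close> by the other part.  If both parts are nonempty, every vertex of \<open>A\<close> is adjacent to
  every vertex of \<open>B\<close>: two vertices on each side span a 4-cycle, and a single vertex on one side
  together with an edge on the other side spans a triangle.  Hence an acyclic induced subgraph
  meeting both sides has exactly one vertex on one side and an independent set on the other, and
  such a subgraph is a star (\<open>acyclic_join_iff\<close>).

  Both polynomials are generating functions of set families by cardinality
  (\<open>sum_card_monom\<close>), so what remains is inclusion--exclusion.  The families
  \<open>{(A, {})}\<close> and \<open>{({}, B)}\<close> give \<open>A(G) + A(H) - 1\<close>, the empty set being common to both.  A single
  vertex of \<open>G\<close> with a nonempty independent set of \<open>H\<close> gives \<open>n\<^sub>G x (I(H) - 1)\<close>, the mirror image
  gives \<open>n\<^sub>H x (I(G) - 1)\<close>, and the pairs of single vertices, counted in both, contribute the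
  correction \<open>- n\<^sub>G n\<^sub>H x\<^sup>2\<close>.  The coefficient of \<open>x\<^sup>2\<close> in the theorem equals \<open>- n\<^sub>G n\<^sub>H\<close> by
  Vandermonde's identity for the binomial coefficient \<open>n choose 2\<close>.
\<close>

section \<open>Cycles under injections and in stars\<close>

definition map_graph :: "('a \<Rightarrow> 'b) \<Rightarrow> 'a graph \<Rightarrow> 'b graph" where
  "map_graph f K = \<lparr>verts = f ` verts K, edges = (`) f ` edges K\<rparr>"

lemma is_cycle_map_graph_iff:
  assumes "inj f"
  shows "is_cycle (map_graph f K) (map f p) \<longleftrightarrow> is_cycle K p"
proof -
  have "{map f p ! i, map f p ! (Suc i mod length p)} \<in> (`) f ` edges K
      \<longleftrightarrow> {p ! i, p ! (Suc i mod length p)} \<in> edges K" if "i < length p" for i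
  proof -
    have "Suc i mod length p < length p"
      using that by (intro mod_less_divisor) auto
    then have "{map f p ! i, map f p ! (Suc i mod length p)} = f ` {p ! i, p ! (Suc i mod length p)}"
      using that by simp
    then show ?thesis
      using inj_image_mem_iff[OF inj_on_image] assms
      by (metis (no_types, lifting) image_iff inj_image_eq_iff)
  qed
  moreover have "f ` set p \<subseteq> f ` verts K \<longleftrightarrow> set p \<subseteq> verts K"
    using assms by (rule inj_image_subset_iff)
  ultimately show ?thesis
    using inj_on_subset[OF assms, of "set p"]
    by (auto simp: is_cycle_def map_graph_def distinct_map)
qed

lemma acyclic_map_graph_iff:
  assumes "inj f"
  shows "acyclic_graph (map_graph f K) \<longleftrightarrow> acyclic_graph K"
proof -
  have "\<exists>q. p = map f q" if "is_cycle (map_graph f K) p" for p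
  proof -
    have "set p \<subseteq> range f"
      using that by (auto simp: is_cycle_def map_graph_def)
    then show ?thesis
      by (metis ex_map_conv image_iff subsetD)
  qed
  then show ?thesis
    unfolding acyclic_graph_def using is_cycle_map_graph_iff[OF assms] by metis
qed

text \<open>In a cycle of length at least three, no vertex lies on all the edges: a vertex lies only on
  the two edges next to it.\<close>

lemma acyclic_if_common_vertex:
  assumes "\<And>e. e \<in> edges K \<Longrightarrow> c \<in> e"
  shows "acyclic_graph K"
  unfolding acyclic_graph_def
proof
  assume "\<exists>p. is_cycle K p"
  then obtain p where len: "3 \<le> length p" and dist: "distinct p"
    and edge: "\<And>i. i < length p \<Longrightarrow> {p ! i, p ! (Suc i mod length p)} \<in> edges K"
    by (auto simp: is_cycle_def)
  have c: "c = p ! i \<or> c = p ! (Suc i mod length p)" if "i < length p" for i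
    using assms[OF edge[OF that]] by auto
  have eq: "p ! i = p ! j \<longleftrightarrow> i = j" if "i < length p" "j < length p" for i j
    using dist that by (rule nth_eq_iff_index_eq)
  have "0 < length p" "1 < length p" "2 < length p"
    and "Suc 0 mod length p = 1" "Suc 1 mod length p = 2"
    using len by (auto simp: mod_less simp flip: length_greater_0_conv)
  note idx = this
  have "c = p ! 0 \<or> c = p ! 1"
    using c[of 0] idx by simp
  then show False
  proof
    assume "c = p ! 0"
    then show False
      using c[of 1] idx eq[of 0 1] eq[of 0 2] by (simp add: numeral_2_eq_2)
  next
    \<comment> \<open>The third edge ends at index 3, or at index 0 if the cycle is a triangle; neither is 1.\<close>
    assume *: "c = p ! 1"
    have "Suc 2 mod length p < length p \<and> Suc 2 mod length p \<noteq> 1"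
    proof (cases "length p = 3")
      case False
      then have "Suc 2 < length p" using len by simp
      then show ?thesis by (simp add: mod_less)
    qed simp
    then show False
      using * c[of 2] idx eq[of 1 2] eq[of 1 "Suc 2 mod length p"] by auto
  qed
qed

lemma is_cycle_triangle:
  assumes "distinct [a, b, c]" "{a, b, c} \<subseteq> verts K"
    and "{a, b} \<in> edges K" "{b, c} \<in> edges K" "{c, a} \<in> edges K"
  shows "is_cycle K [a, b, c]"
proof -
  have "(\<forall>i<Suc (Suc (Suc 0)). P i) \<longleftrightarrow> P 0 \<and> P 1 \<and> P 2" for P :: "nat \<Rightarrow> bool"
    by (auto simp: eval_nat_numeral less_Suc_eq)
  then show ?thesis
    using assms by (simp add: is_cycle_def)
qed

lemma is_cycle_square:
  assumes "distinct [a, b, c, d]" "{a, b, c, d} \<subseteq> verts K"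
    and "{a, b} \<in> edges K" "{b, c} \<in> edges K" "{c, d} \<in> edges K" "{d, a} \<in> edges K"
  shows "is_cycle K [a, b, c, d]"
proof -
  have "(\<forall>i<Suc (Suc (Suc (Suc 0))). P i) \<longleftrightarrow> P 0 \<and> P 1 \<and> P 2 \<and> P 3" for P :: "nat \<Rightarrow> bool"
    by (auto simp: eval_nat_numeral less_Suc_eq)
  then show ?thesis
    using assms by (simp add: is_cycle_def)
qed

section \<open>Acyclic induced subgraphs of a join\<close>

lemma edges_join_cases:
  assumes "e \<in> edges (graph_join G H)"
  obtains e' where "e' \<in> edges G" "e = Inl ` e'"
  | e' where "e' \<in> edges H" "e = Inr ` e'"
  | u v where "u \<in> verts G" "v \<in> verts H" "e = {Inl u, Inr v}"
  using assms by (auto simp: graph_join_def)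

lemma join_edge_simps:
  shows "{Inl u, Inr v} \<in> edges (graph_join G H) \<longleftrightarrow> u \<in> verts G \<and> v \<in> verts H"
    and "{Inr v, Inl u} \<in> edges (graph_join G H) \<longleftrightarrow> u \<in> verts G \<and> v \<in> verts H"
    and "{v, w} \<in> edges H \<Longrightarrow> {Inr v, Inr w} \<in> edges (graph_join G H)"
proof -
  show *: "{Inl u, Inr v} \<in> edges (graph_join G H) \<longleftrightarrow> u \<in> verts G \<and> v \<in> verts H"
    by (auto simp: graph_join_def doubleton_eq_iff)
  show "{Inr v, Inl u} \<in> edges (graph_join G H) \<longleftrightarrow> u \<in> verts G \<and> v \<in> verts H"
    using * by (simp add: insert_commute)
  show "{Inr v, Inr w} \<in> edges (graph_join G H)" if "{v, w} \<in> edges H"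
    using that by (auto simp: graph_join_def intro!: image_eqI[of _ _ "{v, w}"])
qed

lemma induced_join_left:
  assumes "simple_graph G" "simple_graph H"
  shows "induced (graph_join G H) (A <+> {}) = map_graph Inl (induced G A)"
proof -
  have "e \<in> (`) Inl ` {e' \<in> edges G. e' \<subseteq> A}"
    if "e \<in> edges (graph_join G H)" "e \<subseteq> Inl ` A" for e
    using that(1)
  proof (cases rule: edges_join_cases)
    case (1 e')
    then show ?thesis using that(2) by (auto simp: inj_image_subset_iff)
  next
    \<comment> \<open>An edge of the other graph is nonempty and so leaves the given side.\<close>
    case (2 e')
    then have "e' \<noteq> {}" using assms by (auto simp: simple_graph_def)
    then show ?thesis using 2 that(2) by auto
  next
    case (3 u v)
    then show ?thesis using that(2) by auto
  qed
  moreover have "Inl ` e' \<in> edges (graph_join G H)" if "e' \<in> edges G" for e'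
    using that by (simp add: graph_join_def)
  ultimately have "{e \<in> edges (graph_join G H). e \<subseteq> Inl ` A} = (`) Inl ` {e' \<in> edges G. e' \<subseteq> A}"
    by blast
  then show ?thesis
    by (simp add: induced_def map_graph_def Plus_def)
qed

lemma induced_join_right:
  assumes "simple_graph G" "simple_graph H"
  shows "induced (graph_join G H) ({} <+> B) = map_graph Inr (induced H B)"
proof -
  have "e \<in> (`) Inr ` {e' \<in> edges H. e' \<subseteq> B}"
    if "e \<in> edges (graph_join G H)" "e \<subseteq> Inr ` B" for e
    using that(1)
  proof (cases rule: edges_join_cases)
    case (2 e')
    then show ?thesis using that(2) by (auto simp: inj_image_subset_iff)
  next
    \<comment> \<open>An edge of the other graph is nonempty and so leaves the given side.\<close>
    case (1 e')
    then have "e' \<noteq> {}" using assms by (auto simp: simple_graph_def)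
    then show ?thesis using 1 that(2) by auto
  next
    case (3 u v)
    then show ?thesis using that(2) by auto
  qed
  moreover have "Inr ` e' \<in> edges (graph_join G H)" if "e' \<in> edges H" for e'
    using that by (simp add: graph_join_def)
  ultimately have "{e \<in> edges (graph_join G H). e \<subseteq> Inr ` B} = (`) Inr ` {e' \<in> edges H. e' \<subseteq> B}"
    by blast
  then show ?thesis
    by (simp add: induced_def map_graph_def Plus_def)
qed

definition swap_sum :: "'a + 'b \<Rightarrow> 'b + 'a" where
  "swap_sum = case_sum Inr Inl"

lemma swap_sum_simps [simp]:
  "swap_sum (Inl a) = Inr a" "swap_sum (Inr b) = Inl b"
  by (simp_all add: swap_sum_def)

lemma inj_swap_sum: "inj swap_sum"
  by (auto simp: inj_def swap_sum_def split: sum.splits)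

lemma swap_sum_Plus: "swap_sum ` (A <+> B) = B <+> A"
  by (auto simp: Plus_def image_Un image_image)

lemma edges_join_swap: "(`) swap_sum ` edges (graph_join G H) = edges (graph_join H G)"
proof -
  have "{{Inl u, Inr v} | u v. u \<in> verts G \<and> v \<in> verts H}
      = (\<lambda>(u, v). {Inl u, Inr v}) ` (verts G \<times> verts H)"
    by auto
  moreover have "{{Inl v, Inr u} | v u. v \<in> verts H \<and> u \<in> verts G}
      = (\<lambda>(u, v). {Inr u, Inl v}) ` (verts G \<times> verts H)"
    by (auto simp: insert_commute)
  ultimately show ?thesis
    by (simp add: graph_join_def image_Un image_image split_def Un_ac)
qed

text \<open>Exchanging the two sides carries the statement about a single vertex of \<open>G\<close> over to a
  single vertex of \<open>H\<close>.\<close>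

lemma induced_join_swap:
  "induced (graph_join H G) (B <+> A) = map_graph swap_sum (induced (graph_join G H) (A <+> B))"
proof -
  have "{e \<in> edges (graph_join H G). e \<subseteq> B <+> A}
      = (`) swap_sum ` {e \<in> edges (graph_join G H). e \<subseteq> A <+> B}"
    unfolding edges_join_swap[of G H, symmetric] swap_sum_Plus[of A B, symmetric]
    by (auto simp: inj_image_subset_iff[OF inj_swap_sum])
  then show ?thesis
    by (simp add: induced_def map_graph_def swap_sum_Plus)
qed

text \<open>One vertex of \<open>G\<close> dominates \<open>B\<close>: an edge inside \<open>B\<close> closes a triangle with it, and without
  such an edge the induced subgraph is a star centred at it.\<close>

lemma acyclic_join_single_left_iff:
  assumes G: "simple_graph G" and H: "simple_graph H" and u: "u \<in> verts G" and B: "B \<subseteq> verts H"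
  shows "acyclic_graph (induced (graph_join G H) ({u} <+> B)) \<longleftrightarrow> independent_set H B"
proof
  assume ac: "acyclic_graph (induced (graph_join G H) ({u} <+> B))"
  have False if v: "v \<in> B" and w: "w \<in> B" and e: "{v, w} \<in> edges H" for v w
  proof -
    have "v \<noteq> w"
      using H e by (auto simp: simple_graph_def)
    have "is_cycle (induced (graph_join G H) ({u} <+> B)) [Inl u, Inr v, Inr w]"
      using \<open>v \<noteq> w\<close> u v w e B
      by (intro is_cycle_triangle) (auto simp: induced_def join_edge_simps)
    then show False
      using ac by (auto simp: acyclic_graph_def)
  qed
  then show "independent_set H B"
    using B by (auto simp: independent_set_def)
next
  assume ind: "independent_set H B"
  show "acyclic_graph (induced (graph_join G H) ({u} <+> B))"
  proof (rule acyclic_if_common_vertex)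
    fix e assume "e \<in> edges (induced (graph_join G H) ({u} <+> B))"
    then have e: "e \<in> edges (graph_join G H)" and sub: "e \<subseteq> {u} <+> B"
      by (auto simp: induced_def)
    from e show "Inl u \<in> e"
    proof (cases rule: edges_join_cases)
      case (1 e')
      \<comment> \<open>An edge of \<open>G\<close> has two vertices, so it does not fit into \<open>{u}\<close>.\<close>
      then have "card e' = 2" "e' \<subseteq> {u}"
        using G sub by (auto simp: simple_graph_def)
      then have False
        using card_mono[of "{u}" e'] by simp
      then show ?thesis ..
    next
      case (2 e')
      then have "card e' = 2" "e' \<subseteq> B"
        using H sub by (auto simp: simple_graph_def)
      then obtain v w where "e' = {v, w}" "v \<in> B" "w \<in> B"
        by (auto simp: card_2_iff)
      then have False
        using ind 2 by (auto simp: independent_set_def)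
      then show ?thesis ..
    next
      case (3 a b)
      then show ?thesis using sub by auto
    qed
  qed
qed

lemma acyclic_join_single_right_iff:
  assumes "simple_graph G" "simple_graph H" "v \<in> verts H" "A \<subseteq> verts G"
  shows "acyclic_graph (induced (graph_join G H) (A <+> {v})) \<longleftrightarrow> independent_set G A"
  using acyclic_join_single_left_iff[OF assms(2,1,3,4)]
  by (simp add: induced_join_swap[of G H] acyclic_map_graph_iff[OF inj_swap_sum])

lemma not_acyclic_join_if_two_two:
  assumes A: "A \<subseteq> verts G" "a \<in> A" "a' \<in> A" "a \<noteq> a'"
    and B: "B \<subseteq> verts H" "b \<in> B" "b' \<in> B" "b \<noteq> b'"
  shows "\<not> acyclic_graph (induced (graph_join G H) (A <+> B))"
proof -
  have "a \<in> verts G" "a' \<in> verts G" "b \<in> verts H" "b' \<in> verts H"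
    using A B by blast+
  then have "is_cycle (induced (graph_join G H) (A <+> B)) [Inl a, Inr b, Inl a', Inr b']"
    using A(2-) B(2-) by (intro is_cycle_square) (auto simp: induced_def join_edge_simps)
  then show ?thesis
    by (auto simp: acyclic_graph_def)
qed

definition singletons :: "'a set \<Rightarrow> 'a set set" where
  "singletons V = (\<lambda>v. {v}) ` V"

lemma acyclic_join_iff:
  assumes G: "simple_graph G" and H: "simple_graph H" and A: "A \<subseteq> verts G" and B: "B \<subseteq> verts H"
    and ne: "A \<noteq> {}" "B \<noteq> {}"
  shows "acyclic_graph (induced (graph_join G H) (A <+> B)) \<longleftrightarrow>
    A \<in> singletons (verts G) \<and> independent_set H B \<or>
    independent_set G A \<and> B \<in> singletons (verts H)"
    (is "?ac \<longleftrightarrow> ?rhs")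
proof
  assume ?ac
  have two: "\<exists>x\<in>S. \<exists>y\<in>S. x \<noteq> y" if "S \<noteq> {}" "\<not> is_singleton S" for S :: "'c set"
    using that is_singletonI'[of S] by blast
  have "is_singleton A \<or> is_singleton B"
    using two[of A] two[of B] not_acyclic_join_if_two_two[OF A _ _ _ B] \<open>?ac\<close> ne by blast
  then have "(\<exists>u\<in>verts G. A = {u}) \<or> (\<exists>v\<in>verts H. B = {v})"
    using A B by (auto simp: is_singleton_def)
  then show ?rhs
    using \<open>?ac\<close> A B acyclic_join_single_left_iff[OF G H _ B] acyclic_join_single_right_iff[OF G H _ A]
    by (auto simp: singletons_def)
next
  assume ?rhs
  then show ?ac
    using A B acyclic_join_single_left_iff[OF G H _ B] acyclic_join_single_right_iff[OF G H _ A]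
    by (auto simp: singletons_def)
qed

section \<open>Generating functions of set families\<close>

lemma sum_card_monom:
  assumes "finite V"
  shows "(\<Sum>i\<le>card V. monom (int (card {S. S \<subseteq> V \<and> card S = i \<and> P S})) i)
    = (\<Sum>S | S \<subseteq> V \<and> P S. X ^ card S)"
proof -
  have fin: "finite {S. S \<subseteq> V \<and> P S}"
    using assms by simp
  have "(\<Sum>S | S \<subseteq> V \<and> P S. X ^ card S)
      = (\<Sum>i\<le>card V. \<Sum>S | S \<in> {S. S \<subseteq> V \<and> P S} \<and> card S = i. X ^ card S)"
    using fin assms by (intro sum.group[symmetric]) (auto intro: card_mono)
  also have "\<dots> = (\<Sum>i\<le>card V. monom (int (card {S. S \<subseteq> V \<and> card S = i \<and> P S})) i)"
  proof (rule sum.cong[OF refl])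
    fix i
    have "{S \<in> {S. S \<subseteq> V \<and> P S}. card S = i} = {S. S \<subseteq> V \<and> card S = i \<and> P S}"
      by auto
    then have "(\<Sum>S | S \<in> {S. S \<subseteq> V \<and> P S} \<and> card S = i. X ^ card S)
        = (\<Sum>S | S \<subseteq> V \<and> card S = i \<and> P S. X ^ i)"
      by (intro sum.cong) auto
    then show "(\<Sum>S | S \<in> {S. S \<subseteq> V \<and> P S} \<and> card S = i. X ^ card S)
        = monom (int (card {S. S \<subseteq> V \<and> card S = i \<and> P S})) i"
      by (simp add: monom_altdef of_nat_poly)
  qed
  finally show ?thesis ..
qed

definition acyclic_sets :: "'a graph \<Rightarrow> 'a set set" where
  "acyclic_sets G = {S. S \<subseteq> verts G \<and> acyclic_graph (induced G S)}"

definition independent_sets :: "'a graph \<Rightarrow> 'a set set" where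
  "independent_sets G = {S. S \<subseteq> verts G \<and> independent_set G S}"

lemma acyclic_poly_eq_sum:
  "finite (verts G) \<Longrightarrow> acyclic_poly G = (\<Sum>S\<in>acyclic_sets G. X ^ card S)"
  by (simp add: acyclic_poly_def acyclic_sets_def sum_card_monom)

lemma independence_poly_eq_sum:
  assumes "finite (verts G)"
  shows "independence_poly G = (\<Sum>S\<in>independent_sets G. X ^ card S)"
proof -
  have "{S. independent_set G S \<and> card S = k} = {S. S \<subseteq> verts G \<and> card S = k \<and> independent_set G S}" for k
    by (auto simp: independent_set_def)
  then show ?thesis
    using assms by (simp add: independence_poly_def independent_sets_def sum_card_monom)
qed

lemma finite_set_families:
  assumes "finite (verts G)"
  shows "finite (acyclic_sets G)" "finite (independent_sets G)"
  using assms by (simp_all add: acyclic_sets_def independent_sets_def)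

lemma sum_singletons: "(\<Sum>S\<in>singletons V. X ^ card S) = of_nat (card V) * X"
  by (simp add: singletons_def sum.reindex inj_on_def)

lemma empty_in_set_families: "{} \<in> acyclic_sets G" "{} \<in> independent_sets G"
  by (auto simp: acyclic_sets_def independent_sets_def independent_set_def acyclic_graph_def
      is_cycle_def induced_def)

lemma singletons_subset_independent_sets:
  assumes "simple_graph G"
  shows "singletons (verts G) \<subseteq> independent_sets G"
  using assms
  by (auto simp: singletons_def independent_sets_def independent_set_def simple_graph_def)

section \<open>The acyclic polynomial of a join\<close>

text \<open>The four families are grouped by whether one part is empty: the first two overlap only in the
  empty set, the last two in the pairs of single vertices, and the two groups are disjoint.  The
  empty set is removed from the independent sets because a vertex with nothing on the other side
  is already in the first group.\<close>

lemma acyclic_sets_join: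
  assumes G: "simple_graph G" and H: "simple_graph H"
  shows "acyclic_sets (graph_join G H) = (\<lambda>(A, B). A <+> B) `
    ((acyclic_sets G \<times> {{}} \<union> {{}} \<times> acyclic_sets H) \<union>
     (singletons (verts G) \<times> (independent_sets H - {{}}) \<union>
      (independent_sets G - {{}}) \<times> singletons (verts H)))"
    (is "_ = ?f ` ?F")
proof -
  have mem: "A <+> B \<in> acyclic_sets (graph_join G H) \<longleftrightarrow> (A, B) \<in> ?F"
    if "A \<subseteq> verts G" "B \<subseteq> verts H" for A B
  proof -
    have "A <+> B \<subseteq> verts (graph_join G H)"
      using that by (auto simp: graph_join_def)
    then have *: "A <+> B \<in> acyclic_sets (graph_join G H) \<longleftrightarrow>
        acyclic_graph (induced (graph_join G H) (A <+> B))"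
      by (simp add: acyclic_sets_def)
    consider "B = {}" | "A = {}" | "A \<noteq> {}" "B \<noteq> {}" by blast
    then show ?thesis
    proof cases
      case 1
      have "acyclic_graph (induced (graph_join G H) (A <+> {})) \<longleftrightarrow> acyclic_graph (induced G A)"
        by (simp only: induced_join_left[OF G H] acyclic_map_graph_iff inj_Inl)
      then show ?thesis
        using * 1 that empty_in_set_families(1)[of G]
        by (auto simp: singletons_def acyclic_sets_def)
    next
      case 2
      have "acyclic_graph (induced (graph_join G H) ({} <+> B)) \<longleftrightarrow> acyclic_graph (induced H B)"
        by (simp only: induced_join_right[OF G H] acyclic_map_graph_iff inj_Inr)
      then show ?thesis
        using * 2 that empty_in_set_families(1)[of H]
        by (auto simp: singletons_def acyclic_sets_def)
    next
      case 3
      then show ?thesis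
        using * that acyclic_join_iff[OF G H that 3] by (auto simp: independent_sets_def)
    qed
  qed
  show ?thesis
  proof (intro equalityI subsetI)
    fix S assume S: "S \<in> acyclic_sets (graph_join G H)"
    define A where "A = Inl -` S"
    define B where "B = Inr -` S"
    have sub: "S \<subseteq> verts G <+> verts H"
      using S by (auto simp: acyclic_sets_def graph_join_def)
    then have "S = A <+> B" "A \<subseteq> verts G" "B \<subseteq> verts H"
      by (auto simp: A_def B_def)
    then have "S = ?f (A, B)" "(A, B) \<in> ?F"
      using mem S by simp_all
    then show "S \<in> ?f ` ?F" by (rule image_eqI)
  next
    fix S assume "S \<in> ?f ` ?F"
    then obtain A B where S: "S = A <+> B" and F: "(A, B) \<in> ?F" by auto
    from F have "A \<subseteq> verts G" "B \<subseteq> verts H"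
      by (auto simp: acyclic_sets_def independent_sets_def singletons_def)
    then show "S \<in> acyclic_sets (graph_join G H)"
      using mem F S by simp
  qed
qed

lemma choose_two_add:
  "int ((a + b) choose 2) = int (a choose 2) + int (b choose 2) + int a * int b"
proof -
  have "(a + b) choose 2 = (\<Sum>k\<le>2. (a choose k) * (b choose (2 - k)))"
    by (rule vandermonde[symmetric])
  then show ?thesis
    by (simp add: eval_nat_numeral)
qed

lemma acyclic_poly_join:
  assumes G: "simple_graph G" and H: "simple_graph H"
  shows "acyclic_poly (graph_join G H) = acyclic_poly G + acyclic_poly H - 1
    + of_nat (card (verts G)) * X * (independence_poly H - 1)
    + of_nat (card (verts H)) * X * (independence_poly G - 1)
    - of_nat (card (verts G)) * X * (of_nat (card (verts H)) * X)"
proof -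
  have fG: "finite (verts G)" and fH: "finite (verts H)"
    using G H by (auto simp: simple_graph_def)
  define P1 where "P1 = acyclic_sets G \<times> {{} :: 'b set}"
  define P2 where "P2 = {{} :: 'a set} \<times> acyclic_sets H"
  define Q1 where "Q1 = singletons (verts G) \<times> (independent_sets H - {{}})"
  define Q2 where "Q2 = (independent_sets G - {{}}) \<times> singletons (verts H)"
  define w :: "'a set \<times> 'b set \<Rightarrow> int poly" where "w = (\<lambda>(A, B). X ^ card A * X ^ card B)"
  note defs = P1_def P2_def Q1_def Q2_def
  have fin: "finite P1" "finite P2" "finite Q1" "finite Q2"
    using finite_set_families[OF fG] finite_set_families[OF fH] fG fH
    by (auto simp: defs singletons_def)
  have prod: "(\<Sum>z\<in>F \<times> K. w z) = (\<Sum>A\<in>F. X ^ card A) * (\<Sum>B\<in>K. X ^ card B)" for F K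
    unfolding w_def sum.cartesian_product[symmetric] sum_product ..
  have inj: "inj_on (\<lambda>(A, B). A <+> B) (P1 \<union> P2 \<union> (Q1 \<union> Q2))"
    by (rule inj_on_inverseI[where g = "\<lambda>S. (Inl -` S, Inr -` S)"]) auto
  have weight: "X ^ card (A <+> B) = w (A, B)" if "(A, B) \<in> P1 \<union> P2 \<union> (Q1 \<union> Q2)" for A B
  proof -
    have "A \<subseteq> verts G" "B \<subseteq> verts H"
      using that by (auto simp: defs acyclic_sets_def independent_sets_def singletons_def)
    then have "card (A <+> B) = card A + card B"
      using fG fH by (intro card_Plus) (auto intro: finite_subset)
    then show ?thesis by (simp add: w_def power_add)
  qed
  have "(\<Sum>S\<in>acyclic_sets (graph_join G H). X ^ card S)
      = (\<Sum>z\<in>P1 \<union> P2 \<union> (Q1 \<union> Q2). X ^ card (case z of (A, B) \<Rightarrow> A <+> B))"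
    unfolding acyclic_sets_join[OF G H] defs[symmetric] by (simp add: sum.reindex[OF inj])
  also have "\<dots> = (\<Sum>z\<in>P1 \<union> P2 \<union> (Q1 \<union> Q2). w z)"
  proof (rule sum.cong[OF refl])
    fix z assume "z \<in> P1 \<union> P2 \<union> (Q1 \<union> Q2)"
    then show "X ^ card (case z of (A, B) \<Rightarrow> A <+> B) = w z"
      using weight by (cases z) (simp only: case_prod_conv)
  qed
  also have "\<dots> = (\<Sum>z\<in>P1 \<union> P2. w z) + (\<Sum>z\<in>Q1 \<union> Q2. w z)"
    using fin by (intro sum.union_disjoint) (auto simp: defs singletons_def)
  also have "(\<Sum>z\<in>P1 \<union> P2. w z) = sum w P1 + sum w P2 - sum w (P1 \<inter> P2)"
    using fin by (intro sum_Un) auto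
  also have "(\<Sum>z\<in>Q1 \<union> Q2. w z) = sum w Q1 + sum w Q2 - sum w (Q1 \<inter> Q2)"
    using fin by (intro sum_Un) auto
  also have "P1 \<inter> P2 = {({}, {})}"
    using empty_in_set_families(1)[of G] empty_in_set_families(1)[of H] by (auto simp: defs)
  also have "Q1 \<inter> Q2 = singletons (verts G) \<times> singletons (verts H)"
    using singletons_subset_independent_sets[OF G] singletons_subset_independent_sets[OF H]
    by (auto simp: defs singletons_def)
  also have "sum w P1 = acyclic_poly G"
    using fG by (simp add: P1_def prod acyclic_poly_eq_sum)
  also have "sum w P2 = acyclic_poly H"
    using fH by (simp add: P2_def prod acyclic_poly_eq_sum)
  also have "sum w Q1 = of_nat (card (verts G)) * X * (independence_poly H - 1)"
    using fH finite_set_families(2)[OF fH] empty_in_set_families(2)[of H]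
    by (simp only: Q1_def prod sum_singletons independence_poly_eq_sum) (simp add: sum_diff1)
  also have "sum w Q2 = of_nat (card (verts H)) * X * (independence_poly G - 1)"
    using fG finite_set_families(2)[OF fG] empty_in_set_families(2)[of G]
    by (simp only: Q2_def prod sum_singletons independence_poly_eq_sum) (simp add: sum_diff1)
  also have "sum w (singletons (verts G) \<times> singletons (verts H))
      = of_nat (card (verts G)) * X * (of_nat (card (verts H)) * X)"
    by (simp only: prod sum_singletons)
  also have "sum w {({}, {})} = 1"
    by (simp add: w_def)
  finally show ?thesis
    using fG fH by (simp add: acyclic_poly_eq_sum graph_join_def)
qed

theorem theorem1p3:
  fixes G :: "'a graph" and H :: "'b graph" and n n_G n_H :: nat
  assumes "simple_graph G" and "simple_graph H"
    and "n_G = card (verts G)" and "n_H = card (verts H)" and "n = n_G + n_H"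
  shows "acyclic_poly (graph_join G H) =
    acyclic_poly G + acyclic_poly H
    + of_nat n_G * X * independence_poly H + of_nat n_H * X * independence_poly G
    + of_int (int (n choose 2) - 2 * int n_G * int n_H - int (n_G choose 2) - int (n_H choose 2)) * X ^ 2
    - of_nat n * X - 1"
proof -
  have coeff: "int (n choose 2) - 2 * int n_G * int n_H - int (n_G choose 2) - int (n_H choose 2)
      = - (int n_G * int n_H)"
    using choose_two_add[of n_G n_H] assms(5) by simp
  have ring: "aG + aH - 1 + g * x * (iH - 1) + h * x * (iG - 1) - g * x * (h * x)
      = aG + aH + g * x * iH + h * x * iG + - (g * h) * x ^ 2 - (g + h) * x - 1"
    for aG aH g h x iG iH :: "int poly"
    by (simp add: algebra_simps power2_eq_square)
  have "acyclic_poly (graph_join G H) = acyclic_poly G + acyclic_poly H - 1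
    + of_nat n_G * X * (independence_poly H - 1) + of_nat n_H * X * (independence_poly G - 1)
    - of_nat n_G * X * (of_nat n_H * X)"
    unfolding assms(3,4) by (rule acyclic_poly_join[OF assms(1,2)])
  then show ?thesis
    unfolding coeff ring by (simp only: assms(5) of_int_minus of_int_mult of_int_of_nat_eq of_nat_add)
qed

end
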